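(* For every constant $\varepsilon>0$ there is an integer $D=D(\varepsilon)$ such that for all sufficiently large $n$ and for every deterministic exploration strategy using $k\leq D\cdot n^{1+\varepsilon}$ agents, there exists a rooted tree on $n$ vertices and of height $D$ on which the strategy needs at least $D/(5\varepsilon)$ rounds.
   Context: Collaborative tree exploration: a rooted tree $T$ is initially unknown. A team of $k$ agents all start at the root. Time proceeds in synchronous rounds; in each round every agent either stays at its current vertex or moves along an edge incident to its current vertex. The edges incident to a vertex are revealed when that vertex is visited for the first time. Agents may communicate globally and have unlimited memory and computational power; strategies are deterministic. Exploration is complete once every vertex has been visited; a strategy "needs at least $t$ rounds" on $T$ if it has not completed exploration before round $t$. The height of a rooted tree is the maximum distance from the root to a vertex. *)

theory Defs
  imports Complex_Main
begin

section \<open>Rooted trees\<close>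

text \<open>
  A simple undirected graph is given by a vertex set and a set of two-element edges.
\<close>

definition adj :: "'v set set \<Rightarrow> ('v \<times> 'v) set" where
  "adj E = {(u, v). {u, v} \<in> E}"

definition simple_graph :: "'v set \<Rightarrow> 'v set set \<Rightarrow> bool" where
  "simple_graph V E \<longleftrightarrow> finite V \<and> (\<forall>e\<in>E. e \<subseteq> V \<and> card e = 2)"

definition connected_graph :: "'v set \<Rightarrow> 'v set set \<Rightarrow> bool" where
  "connected_graph V E \<longleftrightarrow> V \<noteq> {} \<and> (\<forall>u\<in>V. \<forall>v\<in>V. (u, v) \<in> (adj E)\<^sup>*)"

definition cycle :: "'v set set \<Rightarrow> 'v list \<Rightarrow> bool" where
  "cycle E p \<longleftrightarrow> 3 \<le> length p \<and> distinct p \<and>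
     (\<forall>i<length p. {p ! i, p ! (Suc i mod length p)} \<in> E)"

definition rooted_tree :: "'v set \<Rightarrow> 'v set set \<Rightarrow> 'v \<Rightarrow> bool" where
  "rooted_tree V E r \<longleftrightarrow>
     simple_graph V E \<and> connected_graph V E \<and> (\<nexists>p. cycle E p) \<and> r \<in> V"

definition graph_dist :: "'v set set \<Rightarrow> 'v \<Rightarrow> 'v \<Rightarrow> nat" where
  "graph_dist E u v = (LEAST d. (u, v) \<in> adj E ^^ d)"

definition tree_height :: "'v set \<Rightarrow> 'v set set \<Rightarrow> 'v \<Rightarrow> nat" where
  "tree_height V E r = Max (graph_dist E r ` V)"

section \<open>Collaborative exploration\<close>

text \<open>
  A configuration of \<open>k\<close> agents is the list of length \<open>k\<close> of their current vertices. A history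
  is the list of all configurations so far, oldest first and beginning with the initial one.
\<close>

type_synonym 'v configuration = "'v list"
type_synonym 'v history = "'v configuration list"

definition visited :: "'v history \<Rightarrow> 'v set" where
  "visited h = (\<Union>c\<in>set h. set c)"

definition revealed :: "'v set set \<Rightarrow> 'v history \<Rightarrow> 'v set set" where
  "revealed E h = {e \<in> E. e \<inter> visited h \<noteq> {}}"

text \<open>
  A deterministic strategy maps everything the team knows, namely the history and the set of
  edges revealed so far, to the next configuration. The earlier states of knowledge need not be
  passed separately: they are prefixes of the history together with the revealed edges that
  meet the vertices visited in that prefix. The tree itself is not an argument. Since the current
  vertex of an agent has been visited, all edges incident to it are among the revealed edges, so
  the legality of a move is determined by the latter.
\<close>

type_synonym 'v strategy = "'v history \<Rightarrow> 'v set set \<Rightarrow> 'v configuration"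

definition exploration_strategy :: "nat \<Rightarrow> 'v strategy \<Rightarrow> bool" where
  "exploration_strategy k S \<longleftrightarrow>
     (\<forall>h F. h \<noteq> [] \<and> (\<forall>c\<in>set h. length c = k) \<longrightarrow>
        length (S h F) = k \<and>
        (\<forall>i<k. S h F ! i = last h ! i \<or> {last h ! i, S h F ! i} \<in> F))"

text \<open>\<open>run E r k S s\<close> is the history after \<open>s\<close> completed rounds.\<close>

primrec run :: "'v set set \<Rightarrow> 'v \<Rightarrow> nat \<Rightarrow> 'v strategy \<Rightarrow> nat \<Rightarrow> 'v history" where
  "run E r k S 0 = [replicate k r]"
| "run E r k S (Suc s) = (let h = run E r k S s in h @ [S h (revealed E h)])"

definition explored_after ::
  "'v set \<Rightarrow> 'v set set \<Rightarrow> 'v \<Rightarrow> nat \<Rightarrow> 'v strategy \<Rightarrow> nat \<Rightarrow> bool" where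
  "explored_after V E r k S s \<longleftrightarrow> V \<subseteq> visited (run E r k S s)"

text \<open>
  At least \<open>t\<close> rounds are needed iff no number of rounds smaller than \<open>t\<close> completes exploration;
  \<open>t\<close> need not be an integer.
\<close>

definition needs_at_least ::
  "'v set \<Rightarrow> 'v set set \<Rightarrow> 'v \<Rightarrow> nat \<Rightarrow> 'v strategy \<Rightarrow> real \<Rightarrow> bool" where
  "needs_at_least V E r k S t \<longleftrightarrow> (\<forall>s. real s < t \<longrightarrow> \<not> explored_after V E r k S s)"

end

theory Submission
  imports Defs "HOL-Library.Nat_Bijection" "HOL-Real_Asymp.Real_Asymp"
begin

text \<open>
  The adversary starts with a spider of \<open>q ^ J\<close> legs of length \<open>l\<close>, where \<open>q\<close> is about
  \<open>n powr (2 * \<epsilon>)\<close> and \<open>J\<close> is about \<open>1 / (5 * \<epsilon>)\<close>. Every \<open>l\<close> rounds it keeps only the fraction \<open>1 / q\<close> of the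
  live legs, choosing ones which contain few agents, and gives the unvisited tip of each of them more
  children than these agents can visit in \<open>l\<close> rounds. Agents from other legs need more than \<open>l\<close>
  rounds to get there, so some child remains unvisited and becomes the new tip. Averaging over
  the live legs bounds the new vertices per stage by about \<open>k * l / q\<close>, which is \<open>o(n)\<close>. Thus
  \<open>J + 1\<close> periods of \<open>l\<close> rounds lead the team only to depth \<open>l + J\<close>, with \<open>l\<close> much larger than \<open>J\<close>.
\<close>

section \<open>Trees of lists\<close>

text \<open>
  A vertex is a list, encoded as a natural number; its parent is its tail, its depth its length,
  and the leg of the spider on which it lies is its last entry.
\<close>

definition list_tree :: "nat list set \<Rightarrow> bool" where
  "list_tree A \<longleftrightarrow> finite A \<and> [] \<in> A \<and> (\<forall>x xs. x # xs \<in> A \<longrightarrow> xs \<in> A)"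

definition tree_edges :: "nat list set \<Rightarrow> nat set set" where
  "tree_edges A = {{list_encode (x # xs), list_encode xs} |x xs. x # xs \<in> A}"

lemma tree_edges_iff:
  "{u, v} \<in> tree_edges A \<longleftrightarrow> (\<exists>x xs. x # xs \<in> A \<and>
     (u = list_encode (x # xs) \<and> v = list_encode xs \<or> u = list_encode xs \<and> v = list_encode (x # xs)))"
  unfolding tree_edges_def by (auto simp: doubleton_eq_iff simp del: list_encode.simps)

lemma tree_edges_length:
  assumes "{u, v} \<in> tree_edges A"
  shows "length (list_decode v) \<le> Suc (length (list_decode u))"
  using assms unfolding tree_edges_iff by (auto simp del: list_encode.simps)

lemma tree_edges_parent:
  assumes "{u, v} \<in> tree_edges A" "length (list_decode v) \<le> length (list_decode u)"
  shows "v = list_encode (tl (list_decode u))"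
  using assms unfolding tree_edges_iff by (auto simp del: list_encode.simps)

lemma list_tree_dist_Nil:
  assumes "list_tree A" "xs \<in> A"
  shows "(list_encode [], list_encode xs) \<in> adj (tree_edges A) ^^ length xs"
  using assms(2)
proof (induction xs)
  case (Cons x xs)
  then have "xs \<in> A" using assms(1) unfolding list_tree_def by blast
  moreover have "(list_encode xs, list_encode (x # xs)) \<in> adj (tree_edges A)"
    using Cons.prems unfolding adj_def by (auto simp: tree_edges_iff simp del: list_encode.simps)
  ultimately show ?case using Cons.IH by (auto simp del: list_encode.simps)
qed simp

text \<open>An edge changes the depth by at most one. This gives the lower bound in
  \<open>graph_dist_list_tree\<close>.\<close>

lemma relpow_adj_length:
  assumes "(u, v) \<in> adj (tree_edges A) ^^ d"
  shows "length (list_decode v) \<le> length (list_decode u) + d"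
  using assms
proof (induction d arbitrary: v)
  case (Suc d)
  then obtain w where w: "(u, w) \<in> adj (tree_edges A) ^^ d" "{w, v} \<in> tree_edges A"
    by (auto simp: adj_def)
  show ?case using Suc.IH[OF w(1)] tree_edges_length[OF w(2)] by linarith
qed simp

lemma graph_dist_list_tree:
  assumes "list_tree A" "xs \<in> A"
  shows "graph_dist (tree_edges A) (list_encode []) (list_encode xs) = length xs"
  unfolding graph_dist_def
proof (rule Least_equality)
  show "length xs \<le> d" if "(list_encode [], list_encode xs) \<in> adj (tree_edges A) ^^ d" for d
    using relpow_adj_length[OF that] list_encode_inverse[of "[]"] by simp
qed (rule list_tree_dist_Nil[OF assms])

lemma tree_height_list_tree:
  assumes "list_tree A"
  shows "tree_height (list_encode ` A) (tree_edges A) (list_encode []) = Max (length ` A)"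
  unfolding tree_height_def image_image
  using graph_dist_list_tree[OF assms] by (metis (no_types, lifting) image_cong)

text \<open>Both cycle neighbours of a deepest vertex of a cycle would have to be its parent.\<close>

lemma tree_edges_acyclic: "\<not> cycle (tree_edges A) p"
proof
  assume "cycle (tree_edges A) p"
  then have L: "3 \<le> length p" and dist: "distinct p"
    and ed: "\<And>i. i < length p \<Longrightarrow> {p ! i, p ! (Suc i mod length p)} \<in> tree_edges A"
    unfolding cycle_def by auto
  define dp where "dp i = length (list_decode (p ! i))" for i
  have "Max (dp ` {..<length p}) \<in> dp ` {..<length p}"
    using L by (intro Max_in) (auto simp: lessThan_empty_iff)
  then obtain i where i: "i < length p" and max: "\<And>j. j < length p \<Longrightarrow> dp j \<le> dp i"
    by (metis (no_types, lifting) Max_ge finite_imageI finite_lessThan imageE imageI lessThan_iff)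
  \<comment> \<open>The cyclic predecessor \<open>j\<close> and successor \<open>s\<close> of the
    deepest position \<open>i\<close>.\<close>
  define j where "j = (if i = 0 then length p - 1 else i - 1)"
  define s where "s = (if i = length p - 1 then 0 else Suc i)"
  have j: "j < length p" "Suc j mod length p = i" using i L by (auto simp: j_def)
  have s: "s < length p" "Suc i mod length p = s" using i L by (auto simp: s_def mod_Suc)
  have "p ! s = list_encode (tl (list_decode (p ! i)))"
    using tree_edges_parent[OF ed[OF i]] max[OF s(1)] s(2) by (simp add: dp_def)
  moreover have "p ! j = list_encode (tl (list_decode (p ! i)))"
    using tree_edges_parent[of "p ! i" "p ! j" A] ed[OF j(1)] max[OF j(1)] j(2)
    by (simp add: dp_def insert_commute)
  ultimately have "s = j" using dist s(1) j(1) nth_eq_iff_index_eq by metis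
  \<comment> \<open>Predecessor and successor coincide only on a closed walk of length at most
    two.\<close>
  then show False using i L by (auto simp: s_def j_def split: if_splits)
qed

lemma sym_adj: "sym (adj E)"
  by (auto simp: sym_def adj_def insert_commute)

lemma rooted_tree_list_tree:
  assumes "list_tree A"
  shows "rooted_tree (list_encode ` A) (tree_edges A) (list_encode [])"
proof -
  have "simple_graph (list_encode ` A) (tree_edges A)"
    using assms unfolding simple_graph_def list_tree_def tree_edges_def
    by (auto simp: card_insert_if inj_eq[OF inj_list_encode] simp del: list_encode.simps)
  moreover have "connected_graph (list_encode ` A) (tree_edges A)"
  proof -
    have *: "(list_encode [], list_encode xs) \<in> (adj (tree_edges A))\<^sup>*" if "xs \<in> A" for xs
      using list_tree_dist_Nil[OF assms that] by (rule relpow_imp_rtrancl)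
    have "(list_encode xs, list_encode []) \<in> (adj (tree_edges A))\<^sup>*" if "xs \<in> A" for xs
      using *[OF that] sym_rtrancl[OF sym_adj] by (meson symD)
    with * have "(list_encode xs, list_encode ys) \<in> (adj (tree_edges A))\<^sup>*"
      if "xs \<in> A" "ys \<in> A" for xs ys
      using that by (meson rtrancl_trans)
    then show ?thesis using assms unfolding connected_graph_def list_tree_def by blast
  qed
  ultimately show ?thesis
    using assms tree_edges_acyclic unfolding rooted_tree_def list_tree_def by blast
qed

section \<open>Runs of a strategy\<close>

lemma visited_mono: "set h \<subseteq> set h' \<Longrightarrow> visited h \<subseteq> visited h'"
  by (auto simp: visited_def)

lemma set_run_mono: "s \<le> t \<Longrightarrow> set (run E r k S s) \<subseteq> set (run E r k S t)"
  by (induction t) (auto simp: le_Suc_eq Let_def)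

lemma run_ne_Nil: "run E r k S s \<noteq> []"
  by (cases s) (auto simp: Let_def)

lemma run_length:
  assumes "exploration_strategy k S" "c \<in> set (run E r k S s)"
  shows "length c = k"
  using assms(2)
proof (induction s arbitrary: c)
  case (Suc s)
  have "length (S (run E r k S s) (revealed E (run E r k S s))) = k"
    using assms(1) run_ne_Nil Suc.IH unfolding exploration_strategy_def by metis
  then show ?case using Suc by (auto simp: Let_def)
qed simp

lemma run_step:
  assumes "exploration_strategy k S" "i < k"
  shows "last (run E r k S (Suc s)) ! i = last (run E r k S s) ! i \<or>
    {last (run E r k S s) ! i, last (run E r k S (Suc s)) ! i} \<in> E"
proof -
  let ?h = "run E r k S s"
  have "S ?h (revealed E ?h) ! i = last ?h ! i \<or> {last ?h ! i, S ?h (revealed E ?h) ! i} \<in> revealed E ?h"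
    using assms run_length[OF assms(1)] run_ne_Nil unfolding exploration_strategy_def by metis
  then show ?thesis by (auto simp: Let_def revealed_def)
qed

text \<open>Indexing visits by time and agent is what later allows visited vertices to be counted by
  pairs of a round and an agent.\<close>

lemma visited_run:
  assumes "exploration_strategy k S"
  shows "visited (run E r k S s) = {last (run E r k S t) ! i |t i. t \<le> s \<and> i < k}"
proof (induction s)
  case 0
  then show ?case by (auto simp: visited_def intro!: exI[of _ 0])
next
  case (Suc s)
  let ?c = "last (run E r k S (Suc s))"
  have "length ?c = k" by (rule run_length[OF assms last_in_set[OF run_ne_Nil]])
  then have "set ?c = {?c ! i |i. i < k}" by (auto simp: set_conv_nth)
  moreover have "visited (run E r k S (Suc s)) = visited (run E r k S s) \<union> set ?c"
    by (auto simp: visited_def Let_def)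
  ultimately show ?case unfolding Suc.IH by (auto simp: le_Suc_eq simp del: run.simps)
qed

text \<open>A strategy cannot distinguish two trees before it visits an endpoint of an edge in which they differ.\<close>

lemma run_cong:
  assumes "E \<subseteq> E'" and "\<And>e. e \<in> E' - E \<Longrightarrow> e \<inter> visited (run E r k S T) = {}" and "s \<le> T"
  shows "run E' r k S s = run E r k S s"
  using assms(3)
proof (induction s)
  case (Suc s)
  then have IH: "run E' r k S s = run E r k S s" by simp
  have "visited (run E r k S s) \<subseteq> visited (run E r k S T)"
    using Suc.prems by (intro visited_mono set_run_mono) simp
  then have "revealed E' (run E r k S s) = revealed E (run E r k S s)"
    using assms(1,2) unfolding revealed_def by blast
  then show ?case by (simp add: IH Let_def)
qed simp

text \<open>Since \<open>list_encode\<close> is a bijection, the run can be followed on lists: going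
  up drops the head, going down adds one.\<close>

definition pos :: "nat list set \<Rightarrow> nat \<Rightarrow> nat strategy \<Rightarrow> nat \<Rightarrow> nat \<Rightarrow> nat list" where
  "pos A k S s i = list_decode (last (run (tree_edges A) (list_encode []) k S s) ! i)"

definition seen :: "nat list set \<Rightarrow> nat \<Rightarrow> nat strategy \<Rightarrow> nat \<Rightarrow> nat list set" where
  "seen A k S s = {pos A k S t i |t i. t \<le> s \<and> i < k}"

lemma visited_eq_seen:
  assumes "exploration_strategy k S"
  shows "visited (run (tree_edges A) (list_encode []) k S s) = list_encode ` seen A k S s"
proof -
  have "last (run (tree_edges A) (list_encode []) k S t) ! i = list_encode (pos A k S t i)" for t i
    by (simp add: pos_def)
  then show ?thesis unfolding visited_run[OF assms] seen_def by auto
qed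

lemma seen_mono: "s \<le> t \<Longrightarrow> seen A k S s \<subseteq> seen A k S t"
  unfolding seen_def by fastforce

lemma pos_0: "i < k \<Longrightarrow> pos A k S 0 i = []"
  by (simp add: pos_def)

lemma pos_step:
  assumes "exploration_strategy k S" "i < k"
  shows "pos A k S (Suc s) i = pos A k S s i \<or>
    (\<exists>x. pos A k S s i = x # pos A k S (Suc s) i \<or>
       pos A k S (Suc s) i = x # pos A k S s i \<and> pos A k S (Suc s) i \<in> A)"
  using run_step[OF assms, of "tree_edges A" "list_encode []" s]
  unfolding tree_edges_iff pos_def by (auto simp del: list_encode.simps run.simps)

lemma pos_in_tree:
  assumes "exploration_strategy k S" "i < k" "list_tree A"
  shows "pos A k S s i \<in> A"
proof (induction s)
  case 0
  then show ?case using assms by (simp add: pos_0 list_tree_def)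
next
  case (Suc s)
  then show ?case using pos_step[OF assms(1,2), of A s] assms(3)
    unfolding list_tree_def by metis
qed

lemma seen_subset: "exploration_strategy k S \<Longrightarrow> list_tree A \<Longrightarrow> seen A k S s \<subseteq> A"
  using pos_in_tree unfolding seen_def by blast

lemma pos_length:
  assumes "exploration_strategy k S" "i < k"
  shows "length (pos A k S s i) \<le> s"
proof (induction s)
  case (Suc s)
  then show ?case using pos_step[OF assms, of A s] by auto
qed (simp add: pos_0 assms)

text \<open>Changing the leg of the tree takes an agent through the root.\<close>

lemma pos_same_leg:
  assumes "exploration_strategy k S" "i < k" "d < length (pos A k S (s + d) i)"
  shows "pos A k S s i \<noteq> [] \<and> last (pos A k S s i) = last (pos A k S (s + d) i)"
  using assms(3)
proof (induction d)
  case (Suc d)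
  \<comment> \<open>Going back one round loses at most one unit of depth, so the earlier position is
    still nonempty and both positions end in the same entry.\<close>
  have "d < length (pos A k S (s + d) i) \<and>
      last (pos A k S (s + d) i) = last (pos A k S (s + Suc d) i)"
    using pos_step[OF assms(1,2), of A "s + d"] Suc.prems by auto
  then show ?case using Suc.IH by simp
qed simp

section \<open>The adversary\<close>

definition sprout :: "nat list set \<Rightarrow> nat \<Rightarrow> nat list set" where
  "sprout F c = (\<lambda>(x, f). x # f) ` ({..<c} \<times> F)"

lemma Cons_in_sprout [simp]: "x # f \<in> sprout F c \<longleftrightarrow> x < c \<and> f \<in> F"
  by (auto simp: sprout_def)

lemma Nil_notin_sprout [simp]: "[] \<notin> sprout F c"
  by (auto simp: sprout_def)

lemma finite_sprout: "finite F \<Longrightarrow> finite (sprout F c)"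
  by (simp add: sprout_def)

lemma card_sprout: "card (sprout F c) = c * card F"
  unfolding sprout_def by (subst card_image) (auto simp: inj_on_def card_cartesian_product)

lemma length_sprout: "(\<And>f. f \<in> F \<Longrightarrow> length f = h) \<Longrightarrow> g \<in> sprout F c \<Longrightarrow> length g = Suc h"
  by (auto simp: sprout_def)

lemma list_tree_sprout:
  assumes "list_tree A" "F \<subseteq> A"
  shows "list_tree (A \<union> sprout F c)"
  using assms finite_sprout[OF finite_subset[OF assms(2)]] unfolding list_tree_def by auto

text \<open>Every new edge joins an unvisited vertex of \<open>F\<close> to a vertex outside
  \<open>A\<close>, where no agent can have been. Hence the adversary may decide on these children
  as late as time \<open>T\<close>.\<close>

lemma run_sprout:
  assumes S: "exploration_strategy k S" and A: "list_tree A" and F: "F \<inter> seen A k S T = {}"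
    and s: "s \<le> T"
  shows "run (tree_edges (A \<union> sprout F c)) (list_encode []) k S s =
    run (tree_edges A) (list_encode []) k S s"
proof (rule run_cong[OF _ _ s])
  show "tree_edges A \<subseteq> tree_edges (A \<union> sprout F c)"
    unfolding tree_edges_def by blast
  show "e \<inter> visited (run (tree_edges A) (list_encode []) k S T) = {}"
    if "e \<in> tree_edges (A \<union> sprout F c) - tree_edges A" for e
  proof -
    from that obtain x f where e: "e = {list_encode (x # f), list_encode f}"
      and "x # f \<notin> A" "f \<in> F"
      unfolding tree_edges_def by auto
    then have "x # f \<notin> seen A k S T" "f \<notin> seen A k S T"
      using F seen_subset[OF S A] by auto
    then show ?thesis unfolding e visited_eq_seen[OF S]
      by (auto simp: inj_eq[OF inj_list_encode] simp del: list_encode.simps)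
  qed
qed

lemma seen_sprout:
  assumes "exploration_strategy k S" "list_tree A" "F \<inter> seen A k S T = {}" "s \<le> T"
  shows "seen (A \<union> sprout F c) k S s = seen A k S s"
  using run_sprout[OF assms(1-3)] assms(4) unfolding seen_def pos_def
  by (metis (no_types, opaque_lifting) le_trans)

text \<open>The invariant of the adversary: \<open>F\<close> consists of the live tips, at most one
  per leg and unvisited up to time \<open>T\<close>. Their depth is maximal in \<open>A\<close>, so
  every child attached to them is a new vertex.\<close>

definition frontier ::
  "nat list set \<Rightarrow> nat \<Rightarrow> nat strategy \<Rightarrow> nat \<Rightarrow> nat \<Rightarrow> nat list set \<Rightarrow> bool" where
  "frontier A k S T h F \<longleftrightarrow> list_tree A \<and> F \<subseteq> A \<and> (\<forall>a\<in>A. length a \<le> h) \<and>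
     (\<forall>f\<in>F. length f = h) \<and> inj_on last F \<and> F \<inter> seen A k S T = {}"

text \<open>Double counting: each agent lies on at most one leg, so the crowded legs, those with at
  least \<open>c / l\<close> agents, number at most \<open>k * l / c\<close>. The bound
  \<open>big\<close> leaves \<open>m\<close> others.\<close>

lemma frontier_select:
  assumes fin: "finite F" and inj: "inj_on last F"
    and big: "k * l \<le> c * (card F - m)" and c: "0 < c" and m: "m \<le> card F"
  obtains F' where "F' \<subseteq> F" "card F' = m"
    "\<And>f. f \<in> F' \<Longrightarrow> card {i. i < k \<and> g i = last f} * l < c"
proof -
  define B where "B = {f \<in> F. c \<le> card {i. i < k \<and> g i = last f} * l}"
  have B: "finite B" "B \<subseteq> F" using fin by (auto simp: B_def)
  \<comment> \<open>The sets of agents are disjoint because \<open>last\<close> is injective on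
    \<open>B\<close>.\<close>
  have "(\<Sum>f\<in>B. card {i. i < k \<and> g i = last f}) = card (\<Union>f\<in>B. {i. i < k \<and> g i = last f})"
    using B inj_on_subset[OF inj B(2)] by (subst card_UN_disjoint) (auto simp: inj_on_def)
  also have "\<dots> \<le> card {..<k}" by (intro card_mono) auto
  finally have sum: "(\<Sum>f\<in>B. card {i. i < k \<and> g i = last f}) \<le> k" by simp
  have "c * card B = (\<Sum>f\<in>B. c)" by simp
  also have "\<dots> \<le> (\<Sum>f\<in>B. card {i. i < k \<and> g i = last f} * l)"
    by (intro sum_mono) (auto simp: B_def)
  also have "\<dots> \<le> k * l" using sum by (simp add: sum_distrib_right[symmetric])
  finally have "c * card B \<le> c * (card F - m)" using big by (rule le_trans)
  then have "card B \<le> card F - m" using c by simp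
  moreover have "card (F - B) = card F - card B" using B by (simp add: card_Diff_subset)
  ultimately have "m \<le> card (F - B)" using m by linarith
  then obtain F' where "F' \<subseteq> F - B" "card F' = m" by (meson obtain_subset_with_card_n)
  then show ?thesis using that[of F'] by (force simp: B_def not_le)
qed

lemma frontier_step:
  assumes S: "exploration_strategy k S" and fr: "frontier A k S T h F"
    and l: "0 < l" "l \<le> h"
    and big: "k * l \<le> c * (card F - m)" and c: "0 < c" and m: "m \<le> card F"
  obtains A' F' where "frontier A' k S (T + l) (Suc h) F'" "card F' = m"
    "card A' \<le> card A + c * m"
proof -
  from fr have A: "list_tree A" and FA: "F \<subseteq> A" and hA: "\<And>a. a \<in> A \<Longrightarrow> length a \<le> h"
    and hF: "\<And>f. f \<in> F \<Longrightarrow> length f = h" and inj: "inj_on last F"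
    and un: "F \<inter> seen A k S T = {}"
    unfolding frontier_def by auto
  have finF: "finite F" using A FA by (auto simp: list_tree_def intro: finite_subset)
  \<comment> \<open>An agent at the root is assigned to the unspecified leg \<open>last []\<close>.
    This is harmless: it is still counted at most once, and only upper bounds on the number of
    visitors matter.\<close>
  obtain G where G: "G \<subseteq> F" "card G = m"
    and few: "\<And>f. f \<in> G \<Longrightarrow> card {i. i < k \<and> last (pos A k S T i) = last f} * l < c"
    by (rule frontier_select[OF finF inj big c m, where g = "\<lambda>i. last (pos A k S T i)"])
      blast
  define A' where "A' = A \<union> sprout G c"
  have A': "list_tree A'" unfolding A'_def using list_tree_sprout[OF A] G FA by blast
  have unG: "G \<inter> seen A k S T = {}" using un G by blast
  \<comment> \<open>The set \<open>G\<close> was chosen from the run on \<open>A\<close>; the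
    positions at time \<open>T\<close> are the same in the enlarged tree, so the choice remains
    valid there.\<close>
  have posT: "pos A' k S T i = pos A k S T i" for i
    unfolding A'_def pos_def using run_sprout[OF S A unG order_refl] by simp
  have "\<exists>x<c. x # f \<notin> seen A' k S (T + l)" if f: "f \<in> G" for f
  proof -
    define I where "I = {i. i < k \<and> last (pos A k S T i) = last f}"
    have fh: "length f = h" "f \<in> F" using f G hF by auto
    \<comment> \<open>Each visited child of \<open>f\<close> is charged to a round after
      \<open>T\<close> and an agent that was on the leg of \<open>f\<close> at time
      \<open>T\<close>. There are at most \<open>l * card I < c\<close> such pairs.\<close>
    have "\<exists>(d, i)\<in>{1..l} \<times> I. x # f = pos A' k S (T + d) i" if x: "x # f \<in> seen A' k S (T + l)" for x
    proof -
      from x obtain t i where t: "t \<le> T + l" and i: "i < k" and eq: "x # f = pos A' k S t i"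
        unfolding seen_def by auto
      \<comment> \<open>A child visited by time \<open>T\<close> would already belong to
        \<open>A\<close>, but it is deeper than \<open>h\<close>.\<close>
      have "\<not> t \<le> T"
      proof
        assume "t \<le> T"
        then have "x # f \<in> seen A' k S T" using i eq by (auto simp: seen_def)
        then have "x # f \<in> A"
          using seen_sprout[OF S A unG order_refl] seen_subset[OF S A] unfolding A'_def by blast
        then show False using hA fh by force
      qed
      then obtain d where d: "t = T + d" "d \<in> {1..l}"
        using t by (metis add_le_cancel_left atLeastAtMost_iff le_add1 less_eqE linorder_not_le
            nat_le_linear not_less_eq_eq One_nat_def add.right_neutral le_zero_eq)
      \<comment> \<open>The child has depth \<open>Suc h\<close>, which exceeds \<open>d\<close>
        because \<open>d \<le> l \<le> h\<close>; there was no time to come through the root from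
        another leg.\<close>
      have "last (pos A' k S T i) = last (pos A' k S (T + d) i)"
        using pos_same_leg[OF S i, of d A' T] eq d l(2) fh by (metis Suc_leI atLeastAtMost_iff
            le_trans length_Cons less_Suc_eq_le)
      also have "\<dots> = last f" using eq d(1) fh l by (metis last_ConsR length_0_conv not_less)
      finally have "i \<in> I" using i by (simp add: I_def posT)
      then show ?thesis using d eq by blast
    qed
    then have sub: "{x. x # f \<in> seen A' k S (T + l)} \<subseteq>
        (\<lambda>(d, i). hd (pos A' k S (T + d) i)) ` ({1..l} \<times> I)"
      by (smt (verit, best) case_prod_beta image_iff list.sel(1) mem_Collect_eq subsetI)
    have finI: "finite I" by (simp add: I_def)
    have "card {x. x # f \<in> seen A' k S (T + l)} \<le> card ({1..l} \<times> I)"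
      using surj_card_le[OF _ sub] finI by simp
    also have "\<dots> < card {..<c}"
      using few[OF f] by (simp add: card_cartesian_product I_def mult.commute)
    finally have "\<not> {..<c} \<subseteq> {x. x # f \<in> seen A' k S (T + l)}"
      using finite_subset[OF sub] finI by (meson card_mono finite_SigmaI finite_atLeastAtMost
          finite_imageI not_less)
    then show ?thesis by blast
  qed
  then obtain x where x: "\<And>f. f \<in> G \<Longrightarrow> x f < c \<and> x f # f \<notin> seen A' k S (T + l)"
    by metis
  define F' where "F' = (\<lambda>f. x f # f) ` G"
  \<comment> \<open>For a nonempty tip, adding a head keeps the last entry, so distinct new tips
    stay on distinct legs.\<close>
  have "f \<noteq> []" if "f \<in> G" for f using that G hF l by force
  then have "inj_on last F'"
    using inj G unfolding F'_def by (auto simp: inj_on_def)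
  moreover have "F' \<subseteq> A'" using x by (auto simp: F'_def A'_def)
  moreover have "\<forall>f\<in>F'. length f = Suc h" using G hF by (auto simp: F'_def)
  moreover have "\<forall>a\<in>A'. length a \<le> Suc h"
    using hA length_sprout[of G h] G hF unfolding A'_def by (metis UnE le_SucI order_refl subsetD)
  moreover have "F' \<inter> seen A' k S (T + l) = {}" using x by (auto simp: F'_def)
  ultimately have "frontier A' k S (T + l) (Suc h) F'"
    using A' by (simp add: frontier_def)
  moreover have "card F' = m" unfolding F'_def using G by (subst card_image) (auto simp: inj_on_def)
  moreover have "card A' \<le> card A + c * m"
    unfolding A'_def using card_Un_le[of A "sprout G c"] by (simp add: card_sprout G)
  ultimately show ?thesis using that by blast
qed

text \<open>The spider with \<open>m\<close> legs of length \<open>l\<close>. Its tips are unvisited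
  at time \<open>l - 1\<close> because an agent gains at most one unit of depth per round.\<close>

lemma frontier_init:
  assumes S: "exploration_strategy k S" and l: "0 < l"
  obtains A F where "frontier A k S (l - 1) l F" "card F = m" "card A \<le> 1 + l * m"
proof -
  \<comment> \<open>The vertex of depth \<open>a + 1\<close> on leg \<open>i\<close>: the last entry
    names the leg, and the zeros make it a path.\<close>
  define leg :: "nat \<Rightarrow> nat \<Rightarrow> nat list" where "leg a i = replicate a 0 @ [i]" for a i
  define A where "A = insert [] ((\<lambda>(a, i). leg a i) ` ({..<l} \<times> {..<m}))"
  define F where "F = leg (l - 1) ` {..<m}"
  have fin: "finite A" by (simp add: A_def)
  have "card A \<le> Suc (card ((\<lambda>(a, i). leg a i) ` ({..<l} \<times> {..<m})))"
    unfolding A_def by (simp add: card_insert_if)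
  also have "card ((\<lambda>(a, i). leg a i) ` ({..<l} \<times> {..<m})) \<le> l * m"
    using card_image_le[of "{..<l} \<times> {..<m}" "\<lambda>(a, i). leg a i"] by (simp add: card_cartesian_product)
  finally have cA: "card A \<le> 1 + l * m" by simp
  have cF: "card F = m" unfolding F_def by (subst card_image) (auto simp: inj_on_def leg_def)
  have "xs \<in> A" if xs: "x # xs \<in> A" for x xs
  proof -
    from xs obtain a i where ai: "x # xs = leg a i" "a < l" "i < m" by (auto simp: A_def)
    show ?thesis
    proof (cases a)
      case 0
      then show ?thesis using ai by (simp add: leg_def A_def)
    next
      case (Suc b)
      then have "xs = leg b i" "b < l" using ai by (auto simp: leg_def)
      then show ?thesis using ai(3) by (force simp: A_def)
    qed
  qed
  then have "list_tree A" using fin by (auto simp: list_tree_def A_def)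
  moreover have "F \<subseteq> A" using l by (force simp: F_def A_def)
  moreover have "\<forall>a\<in>A. length a \<le> l" by (auto simp: A_def leg_def)
  moreover have lF: "\<forall>f\<in>F. length f = l" using l by (auto simp: F_def leg_def)
  moreover have "inj_on last F" by (auto simp: F_def leg_def inj_on_def)
  moreover have "f \<notin> F" if "f \<in> seen A k S (l - 1)" for f
  proof -
    from that obtain t i where "t \<le> l - 1" "i < k" "f = pos A k S t i" by (auto simp: seen_def)
    then have "length f < l" using pos_length[OF S, of i A t] l by simp
    then show ?thesis using lF by auto
  qed
  ultimately have "frontier A k S (l - 1) l F" unfolding frontier_def by blast
  then show ?thesis using that cF cA by blast
qed

text \<open>Each stage takes \<open>l\<close> rounds, deepens the tree by one and divides the number
  of tips by \<open>q\<close>. Its cost in vertices is bounded by the same quantity for all stages,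
  since few live tips get many children each.\<close>

lemma frontier_iterate:
  assumes S: "exploration_strategy k S" and l: "0 < l" and q: "1 < q" and j: "j \<le> J"
  shows "\<exists>A F. frontier A k S (Suc j * l - 1) (l + j) F \<and> card F = q ^ (J - j) \<and>
    card A \<le> 1 + l * q ^ J + j * (k * l div (q - 1) + q ^ J)"
  using j
proof (induction j)
  case 0
  then show ?case using frontier_init[OF S l, of "q ^ J"] by (metis add.right_neutral diff_zero
        mult_1 mult_is_0 One_nat_def)
next
  case (Suc j)
  then obtain A F where fr: "frontier A k S (Suc j * l - 1) (l + j) F"
    and F: "card F = q ^ (J - j)"
    and A: "card A \<le> 1 + l * q ^ J + j * (k * l div (q - 1) + q ^ J)"
    by auto
  define m where "m = q ^ (J - Suc j)"
  \<comment> \<open>As \<open>card F - m = (q - 1) * m\<close>, the least \<open>c\<close> with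
    \<open>k * l < c * (card F - m)\<close>; the added one also makes \<open>c\<close>
    positive.\<close>
  define c where "c = k * l div (q - 1) div m + 1"
  have m: "0 < m" using q by (simp add: m_def)
  have Fm: "card F = q * m" using Suc.prems F unfolding m_def
    by (metis Suc_diff_le diff_Suc_Suc power_Suc)
  have diff: "card F - m = (q - 1) * m" using Fm by (simp add: diff_mult_distrib)
  have "k * l < (k * l div ((q - 1) * m) + 1) * ((q - 1) * m)"
    using dividend_less_times_div[of "(q - 1) * m" "k * l"] m q by (simp add: algebra_simps)
  then have big: "k * l \<le> c * (card F - m)"
    by (simp add: c_def diff div_mult2_eq)
  have le: "m \<le> card F" using Fm q by simp
  obtain A' F' where fr': "frontier A' k S (Suc j * l - 1 + l) (Suc (l + j)) F'" "card F' = m"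
    and A': "card A' \<le> card A + c * m"
    using frontier_step[OF S fr l _ big _ le] by (auto simp: c_def)
  have "m \<le> q ^ J" unfolding m_def using q by (intro power_increasing) auto
  \<comment> \<open>Rounding \<open>c\<close> up costs at most \<open>m\<close> further vertices,
    estimated by \<open>q ^ J\<close>.\<close>
  then have "c * m \<le> k * l div (q - 1) + q ^ J"
    unfolding c_def distrib_right by (intro add_mono) simp_all
  then have "card A' \<le> 1 + l * q ^ J + Suc j * (k * l div (q - 1) + q ^ J)"
    using A A' by simp
  moreover have "Suc j * l - 1 + l = Suc (Suc j) * l - 1" using l by simp
  ultimately show ?case using fr' unfolding m_def by (metis add_Suc_right)
qed

text \<open>After \<open>J\<close> stages a single tip \<open>f\<close> is left, unvisited before
  time \<open>Suc J * l\<close>. Hanging all missing vertices below \<open>f\<close> adjusts the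
  size to exactly \<open>n\<close> without affecting the run up to then.\<close>

lemma adversary_tree:
  fixes S :: "nat strategy"
  assumes S: "exploration_strategy k S" and l: "0 < l" and q: "1 < q"
    and n: "1 + l * q ^ J + J * (k * l div (q - 1) + q ^ J) < n"
  obtains V E r where "rooted_tree V E r" "card V = n" "tree_height V E r = l + J + 1"
    "\<And>s. s < Suc J * l \<Longrightarrow> \<not> explored_after V E r k S s"
proof -
  obtain A F where fr: "frontier A k S (Suc J * l - 1) (l + J) F" and F: "card F = 1"
    and A: "card A < n"
    using frontier_iterate[OF S l q order_refl, of J] n by (auto dest: le_less_trans)
  obtain f where f: "F = {f}" using F by (meson card_1_singletonE)
  have At: "list_tree A" and fA: "f \<in> A" "{f} \<subseteq> A" and hf: "length f = l + J"
    and hA: "\<And>a. a \<in> A \<Longrightarrow> length a \<le> l + J"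
    and un: "{f} \<inter> seen A k S (Suc J * l - 1) = {}"
    using fr f unfolding frontier_def by auto
  have finA: "finite A" using At by (simp add: list_tree_def)
  \<comment> \<open>This is positive since \<open>card A < n\<close>, so the height is exactly
    \<open>l + J + 1\<close>.\<close>
  define c where "c = n - card A"
  define B where "B = A \<union> sprout {f} c"
  have lenP: "\<And>g. g \<in> sprout {f} c \<Longrightarrow> length g = l + J + 1"
    using hf length_sprout[of "{f}" "l + J"] by simp
  have B: "list_tree B" unfolding B_def using list_tree_sprout[OF At fA(2)] .
  have "A \<inter> sprout {f} c = {}" using lenP hA by fastforce
  then have "card B = n" unfolding B_def
    using finA A by (simp add: card_Un_disjoint finite_sprout card_sprout c_def)
  then have cB: "card (list_encode ` B) = n"
    by (simp add: card_image[OF inj_list_encode])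
  have "0 # f \<in> B" using A by (simp add: B_def c_def)
  have "Max (length ` B) = l + J + 1"
  proof (intro Max_eqI)
    show "d \<le> l + J + 1" if "d \<in> length ` B" for d
      using that hA lenP by (fastforce simp: B_def)
    show "l + J + 1 \<in> length ` B"
      using \<open>0 # f \<in> B\<close> hf by (intro image_eqI[of _ _ "0 # f"]) simp_all
  qed (use B in \<open>simp add: list_tree_def\<close>)
  moreover have "\<not> explored_after (list_encode ` B) (tree_edges B) (list_encode []) k S s"
    if "s < Suc J * l" for s
  proof -
    have "f \<notin> seen B k S s"
      using un seen_sprout[OF S At un, of s c] seen_mono[of s "Suc J * l - 1"] that
      unfolding B_def by fastforce
    moreover have "f \<in> B" using fA by (simp add: B_def)
    ultimately show ?thesis
      unfolding explored_after_def visited_eq_seen[OF S]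
      by (simp add: inj_image_subset_iff[OF inj_list_encode]) blast
  qed
  ultimately show ?thesis
    using that rooted_tree_list_tree[OF B] cB tree_height_list_tree[OF B] by metis
qed

section \<open>Choice of the parameters\<close>

text \<open>With \<open>l\<close>, \<open>J\<close>, \<open>D\<close> fixed and \<open>q\<close> of
  order \<open>n powr (2 * \<epsilon>)\<close>, the legs and the rounding cost
  O(\<open>n powr (2/5)\<close>), by \<open>J * \<epsilon> \<le> 1 / 5\<close>. The term from the
  agents has exponent \<open>1 + \<epsilon> - 2 * \<epsilon> = 1 - \<epsilon>\<close>. Both are
  o(n).\<close>

lemma size_bound:
  fixes \<epsilon> :: real and J l D :: nat
  assumes eps: "\<epsilon> > 0" and J: "J * \<epsilon> \<le> 1 / 5"
  shows "\<exists>N. \<forall>n\<ge>N. \<forall>k. real k \<le> real D * real n powr (1 + \<epsilon>) \<longrightarrow>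
    (let q = nat \<lceil>real n powr (2 * \<epsilon>)\<rceil> + 1
     in 1 < q \<and> 1 + l * q ^ J + J * (k * l div (q - 1) + q ^ J) < n)"
proof -
  define a b :: real where "a = real (l + J) * 3 ^ J" and "b = real (J * D * l)"
  \<comment> \<open>The size bound divided by \<open>n\<close>.\<close>
  have "(\<lambda>n. 1 / real n + (a * real n powr (-3/5) + b * real n powr (- \<epsilon>))) \<longlonglongrightarrow> 0 + (a * 0 + b * 0)"
    by (intro tendsto_add tendsto_mult tendsto_const; use eps in real_asymp)
  then have "\<forall>\<^sub>F n in sequentially. 1 / real n + (a * real n powr (-3/5) + b * real n powr (- \<epsilon>)) < 1"
    by (rule order_tendstoD(2)) simp
  then have "\<forall>\<^sub>F n in sequentially. 1 + a * real n powr (2/5) + b * real n powr (1 - \<epsilon>) < real n"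
    using eventually_gt_at_top[of 0]
  proof eventually_elim
    case (elim n)
    have "real n * real n powr t = real n powr (1 + t)" for t
      using elim by (simp add: powr_add)
    then have "real n * (1 / real n + (a * real n powr (-3/5) + b * real n powr (- \<epsilon>))) =
        1 + a * real n powr (2/5) + b * real n powr (1 - \<epsilon>)"
      using elim by (simp add: distrib_left mult.left_commute[of "real n"])
    then show ?case using elim mult_strict_left_mono[OF elim(1), of "real n"] by simp
  qed
  then obtain N where N: "\<And>n. n \<ge> N \<Longrightarrow> 1 + a * real n powr (2/5) + b * real n powr (1 - \<epsilon>) < real n"
    by (auto simp: eventually_sequentially)
  show ?thesis
  proof (intro exI[of _ "N + 1"] allI impI)
    fix n k
    assume n: "N + 1 \<le> n" and k: "real k \<le> real D * real n powr (1 + \<epsilon>)"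
    define p where "p = real n powr (2 * \<epsilon>)"
    define q where "q = nat \<lceil>p\<rceil> + 1"
    have p: "1 \<le> p" unfolding p_def using n eps by (intro ge_one_powr_ge_zero) auto
    \<comment> \<open>Here \<open>q - 1\<close> is the ceiling of \<open>p\<close>, and
      \<open>q \<le> p + 2 \<le> 3 * p\<close>; hence the factor \<open>3 ^ J\<close> in
      \<open>a\<close>.\<close>
    then have q: "p \<le> real (q - 1)" "real q \<le> 3 * p" "1 < q" unfolding q_def by linarith+
    have "real q ^ J \<le> (3 * p) ^ J" using q(2) by (intro power_mono) auto
    also have "\<dots> = 3 ^ J * real n powr (2 * (J * \<epsilon>))"
      using n by (simp add: p_def power_mult_distrib powr_power mult_ac)
    also have "\<dots> \<le> 3 ^ J * real n powr (2/5)"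
    proof (intro mult_left_mono powr_mono)
      show "2 * (J * \<epsilon>) \<le> 2/5" using J by linarith
    qed (use n in auto)
    finally have qJ: "real q ^ J \<le> 3 ^ J * real n powr (2/5)" .
    have "real (k * l div (q - 1)) \<le> real (k * l) / real (q - 1)"
      by (rule of_nat_div_le_of_nat)
    also have "\<dots> \<le> (real D * real n powr (1 + \<epsilon>) * l) / p"
      using k q p by (intro frac_le) (auto intro!: mult_right_mono)
    also have "\<dots> = real (D * l) * real n powr (1 - \<epsilon>)"
      using n by (simp add: p_def divide_simps powr_add[symmetric] add.commute)
    finally have kl: "real (k * l div (q - 1)) \<le> real (D * l) * real n powr (1 - \<epsilon>)" .
    have "real (1 + l * q ^ J + J * (k * l div (q - 1) + q ^ J)) =
        1 + real (l + J) * real q ^ J + J * real (k * l div (q - 1))"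
      by (simp add: algebra_simps)
    also have "\<dots> \<le> 1 + real (l + J) * (3 ^ J * real n powr (2/5)) + J * (real (D * l) * real n powr (1 - \<epsilon>))"
      using qJ kl by (intro add_mono mult_left_mono) auto
    also have "\<dots> \<le> 1 + a * real n powr (2/5) + b * real n powr (1 - \<epsilon>)"
      by (simp add: a_def b_def algebra_simps)
    also have "\<dots> < real n" using N n by simp
    finally have "1 + l * q ^ J + J * (k * l div (q - 1) + q ^ J) < n" by linarith
    then show "let q = nat \<lceil>real n powr (2 * \<epsilon>)\<rceil> + 1
      in 1 < q \<and> 1 + l * q ^ J + J * (k * l div (q - 1) + q ^ J) < n"
      using q(3) by (simp add: Let_def q_def p_def)
  qed
qed

theorem theorem2:
  fixes \<epsilon> :: real
  assumes "\<epsilon> > 0"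
  shows "\<exists>D::nat. D \<ge> 1 \<and>
    (\<exists>N. \<forall>n\<ge>N. \<forall>k (S :: nat strategy).
       exploration_strategy k S \<and> real k \<le> real D * real n powr (1 + \<epsilon>) \<longrightarrow>
       (\<exists>(V :: nat set) E r.
          rooted_tree V E r \<and> card V = n \<and> tree_height V E r = D \<and>
          needs_at_least V E r k S (real D / (5 * \<epsilon>))))"
proof -
  define x where "x = 1 / (5 * \<epsilon>)"
  \<comment> \<open>Rounds per unit of height are \<open>(J + 1) * l / (l + J + 1)\<close>, which
    tends to \<open>J + 1\<close> as \<open>l\<close> grows. Taking the floor makes
    \<open>J + 1\<close> strictly larger than the required ratio \<open>x\<close>. If \<epsilon>
    exceeds 1/5, then \<open>J = 0\<close> and the spider alone suffices.\<close>
  define J where "J = nat \<lfloor>x\<rfloor>"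
  have x: "0 < x" "real J \<le> x" "x < real J + 1" using assms by (auto simp: x_def J_def)
  have J: "J * \<epsilon> \<le> 1 / 5" using x(2) assms by (simp add: x_def field_simps)
  \<comment> \<open>Solving \<open>(l + J + 1) * x < (J + 1) * l\<close> for \<open>l\<close>; the
    denominator is positive by the choice of \<open>J\<close>.\<close>
  obtain l :: nat where l: "(real J + 1) * x / (real J + 1 - x) < real l"
    using reals_Archimedean2 by blast
  have l0: "0 < l" using l x by (smt (verit) divide_nonneg_pos mult_nonneg_nonneg of_nat_0_less_iff
        of_nat_0_le_iff)
  define D where "D = l + J + 1"
  have "(real J + 1) * x < real l * (real J + 1 - x)" using l x by (simp add: pos_divide_less_eq)
  then have Dx: "real D * x \<le> real (Suc J * l)" by (simp add: D_def algebra_simps)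
  obtain N where N: "\<And>n k. n \<ge> N \<Longrightarrow> real k \<le> real D * real n powr (1 + \<epsilon>) \<Longrightarrow>
      \<exists>q. 1 < q \<and> 1 + l * q ^ J + J * (k * l div (q - 1) + q ^ J) < n"
    using size_bound[OF assms J, of D l] unfolding Let_def by blast
  show ?thesis
  proof (rule exI[of _ D], rule conjI, simp add: D_def, rule exI[of _ N], intro allI impI)
    fix n k and S :: "nat strategy"
    assume n: "N \<le> n" and k: "exploration_strategy k S \<and> real k \<le> real D * real n powr (1 + \<epsilon>)"
    obtain q where q: "1 < q" "1 + l * q ^ J + J * (k * l div (q - 1) + q ^ J) < n"
      using N n k by blast
    obtain V E r where T: "rooted_tree V E r" "card V = n" "tree_height V E r = D"
      and un: "\<And>s. s < Suc J * l \<Longrightarrow> \<not> explored_after V E r k S s"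
      using adversary_tree[OF conjunct1[OF k] l0 q] unfolding D_def by metis
    have "needs_at_least V E r k S (real D / (5 * \<epsilon>))"
      unfolding needs_at_least_def
    proof (intro allI impI un)
      fix s assume "real s < real D / (5 * \<epsilon>)"
      then have "real s < real (Suc J * l)" using Dx by (simp add: x_def)
      then show "s < Suc J * l" by linarith
    qed
    with T show "\<exists>V E r. rooted_tree V E r \<and> card V = n \<and> tree_height V E r = D \<and>
        needs_at_least V E r k S (real D / (5 * \<epsilon>))" by blast
  qed
qed

end
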